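(* Let $T, L, D \ge 1$ be integers, and let $\bar{W} = [\,W \ \ b\,] \in \mathbb{R}^{T \times (L+1)}$ be the parameters of the linear decoder of the multi-task forecasting (MT-F) paradigm, with weights $W \in \mathbb{R}^{T \times L}$ and bias $b \in \mathbb{R}^{T}$. The decoder maps an encoder representation $R \in \mathbb{R}^{L \times D}$ to the forecast $\hat{Y} = WR + b$ ($b$ added to every column), that is, $\hat Y=\bar W\bar R$ where $\bar R$ is $R$ with a row of ones appended. Let $Y \in \mathbb{R}^{T \times D}$ be the label sequence and $\epsilon = Y - \hat{Y}$ the estimation error. Then the minimum attainable estimation error (over the representations $R$ provided by the encoder, with $\bar W$ and $Y$ fixed) is $$\|\epsilon\|_F^2 = \sum_{t=\mathrm{rank}(\bar{W})+1}^{T} \|U_t^\top Y\|_2^2 ,$$ where $\bar{W} = U \Sigma V^\top$ is the singular value decomposition of $\bar{W}$, $U_t$ is the $t$-th column of $U$, $\mathrm{rank}(\bar{W}) \le \min\{T, L+1\}$, and $\{U_t\}_{t=\mathrm{rank}(\bar{W})+1}^{T}$ form an orthonormal basis of the left null space $\{u \in \mathbb{R}^T : \bar{W}^\top u = 0\}$ of $\bar{W}$. Notably, this error is independent of the representation $R$ provided by the encoder.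
   Context: Setting: time-series forecasting with $D$ covariates, history length $L$ and forecast horizon $T$. An encoder turns the historical sequence into a representation $R \in \mathbb{R}^{L \times D}$, and the MT-F decoder produces all $T$ forecast steps at once by one linear layer: the prediction for step $t$ is $\hat{Y}_t = W_t R + b_t$, where $W_t$ is the $t$-th row of $W$ and $b_t$ the $t$-th entry of $b$. In the singular value decomposition, $U \in \mathbb{R}^{T\times T}$ and $V \in \mathbb{R}^{(L+1)\times(L+1)}$ are orthogonal and $\Sigma \in \mathbb{R}^{T \times (L+1)}$ is diagonal with the positive singular values listed first. $\|\cdot\|_F$ is the Frobenius norm and $\|\cdot\|_2$ the Euclidean norm. An empty sum equals $0$.
   Formalization: The minimum over R is proved when b lies in the column space of W; otherwise it can fail (T=L=D=1, W=0, b=1, Y=0). For any b the sum is proved a lower bound for all R, and the attained minimum when the last row of the augmented representation need not be ones. *)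

theory Defs
  imports
    "Jordan_Normal_Form.DL_Rank"
    "Jordan_Normal_Form.Matrix_Kernel"
begin

definition frob_norm :: "real mat \<Rightarrow> real" where
  "frob_norm A = sqrt (\<Sum>i<dim_row A. \<Sum>j<dim_col A. (A $$ (i, j))\<^sup>2)"

definition euclid_norm :: "real vec \<Rightarrow> real" where
  "euclid_norm v = sqrt (v \<bullet> v)"

definition aug_weights :: "real mat \<Rightarrow> real vec \<Rightarrow> real mat" where
  "aug_weights W b = mat_of_cols (dim_row W) (cols W @ [b])"

definition aug_repr :: "real mat \<Rightarrow> real mat" where
  "aug_repr R = R @\<^sub>r mat 1 (dim_col R) (\<lambda>_. 1)"

definition forecast :: "real mat \<Rightarrow> real vec \<Rightarrow> real mat \<Rightarrow> real mat" where
  "forecast W b R = W * R + mat (dim_row W) (dim_col R) (\<lambda>(i, j). b $ i)"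

text \<open>The library predicate \<open>orthogonal_mat\<close> only asks for pairwise orthogonal nonzero
  columns, so orthogonality of \<open>U\<close> and \<open>V\<close> is spelled out. The positive singular values come
  first; they need not be in decreasing order.\<close>

definition is_svd :: "real mat \<Rightarrow> real mat \<Rightarrow> real mat \<Rightarrow> real mat \<Rightarrow> bool" where
  "is_svd A U S V \<longleftrightarrow>
     U \<in> carrier_mat (dim_row A) (dim_row A) \<and> U\<^sup>T * U = 1\<^sub>m (dim_row A) \<and>
     V \<in> carrier_mat (dim_col A) (dim_col A) \<and> V\<^sup>T * V = 1\<^sub>m (dim_col A) \<and>
     S \<in> carrier_mat (dim_row A) (dim_col A) \<and> diagonal_mat S \<and>
     (\<forall>i < min (dim_row A) (dim_col A). 0 \<le> S $$ (i, i)) \<and>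
     (\<forall>i j. i \<le> j \<longrightarrow> j < min (dim_row A) (dim_col A) \<longrightarrow> 0 < S $$ (j, j) \<longrightarrow> 0 < S $$ (i, i)) \<and>
     A = U * S * V\<^sup>T"

definition left_null_space :: "real mat \<Rightarrow> real vec set" where
  "left_null_space A = mat_kernel (A\<^sup>T)"

text \<open>Linear independence of the family follows from orthonormality.\<close>

definition is_orthonormal_basis ::
    "nat \<Rightarrow> nat set \<Rightarrow> (nat \<Rightarrow> real vec) \<Rightarrow> real vec set \<Rightarrow> bool" where
  "is_orthonormal_basis n I f N \<longleftrightarrow>
     f ` I \<subseteq> carrier_vec n \<and>
     (\<forall>i\<in>I. \<forall>j\<in>I. f i \<bullet> f j = (if i = j then 1 else 0)) \<and>
     LinearCombinations.module.span class_ring (module_vec TYPE(real) n) (f ` I) = N"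

definition is_minimum :: "real \<Rightarrow> real set \<Rightarrow> bool" where
  "is_minimum m S \<longleftrightarrow> m \<in> S \<and> (\<forall>x\<in>S. m \<le> x)"

text \<open>The columns of \<open>U\<close> are numbered from \<open>0\<close>, so \<open>t = rank + 1, \<dots>, T\<close> becomes
  \<open>t \<in> {rank..<T}\<close>; \<open>U\<^sub>t\<^sup>T Y\<close> is written as the column vector \<open>Y\<^sup>T U\<^sub>t\<close>.\<close>

definition residual_energy :: "nat \<Rightarrow> real mat \<Rightarrow> nat \<Rightarrow> real mat \<Rightarrow> real" where
  "residual_energy T U r Y = (\<Sum>t\<in>{r..<T}. (euclid_norm (Y\<^sup>T *\<^sub>v col U t))\<^sup>2)"

text \<open>Because the last row of \<open>aug_repr R\<close> is constrained to be constantly one, the residual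
  energy of \<open>[W b]\<close> is in general only a lower bound for the errors over all \<open>R\<close>. If \<open>b\<close> is not in
  the column space of \<open>W\<close> it is not attained for \<open>Y = 0\<close>: it then equals \<open>0\<close>, while every error
  is positive.\<close>

lemma residual_energy_zero:
  assumes "U \<in> carrier_mat T T"
  shows "residual_energy T U r (0\<^sub>m T D) = 0"
proof -
  have "euclid_norm ((0\<^sub>m T D)\<^sup>T *\<^sub>v col U t) = 0" if "t < T" for t
  proof -
    have "(0\<^sub>m T D)\<^sup>T *\<^sub>v col U t = (0\<^sub>v D :: real vec)"
      using assms that by (intro eq_vecI) (auto simp: scalar_prod_def)
    then show ?thesis by (simp add: euclid_norm_def)
  qed
  then show ?thesis unfolding residual_energy_def by (intro sum.neutral) auto
qed

lemma error_positive_if_bias_not_in_col_space: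
  assumes W: "W \<in> carrier_mat T L" and b: "b \<in> carrier_vec T"
    and nb: "b \<notin> vec_space.col_space T W"
    and D: "1 \<le> D" and R: "R \<in> carrier_mat L D"
  shows "0 < (frob_norm (0\<^sub>m T D - forecast W b R))\<^sup>2"
proof (rule ccontr)
  define E where "E = 0\<^sub>m T D - forecast W b R"
  have dE: "dim_row E = T" "dim_col E = D" using W R by (auto simp: E_def forecast_def)
  have nn: "0 \<le> (\<Sum>i<T. \<Sum>j<D. (E $$ (i, j))\<^sup>2)" by (intro sum_nonneg) auto
  assume "\<not> 0 < (frob_norm (0\<^sub>m T D - forecast W b R))\<^sup>2"
  then have "(\<Sum>i<T. \<Sum>j<D. (E $$ (i, j))\<^sup>2) = 0"
    using nn by (simp add: E_def[symmetric] frob_norm_def dE)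
  then have z: "E $$ (i, 0) = 0" if "i < T" for i
    using that D by (subst (asm) sum_nonneg_eq_0_iff) (auto simp: sum_nonneg_eq_0_iff sum_nonneg)
  have "W *\<^sub>v (- col R 0) = b"
  proof (rule eq_vecI)
    fix i assume "i < dim_vec b"
    then have i: "i < T" using b by simp
    have "E $$ (i, 0) = - (row W i \<bullet> col R 0 + b $ i)"
      using i D W R by (simp add: E_def forecast_def)
    then show "(W *\<^sub>v (- col R 0)) $ i = b $ i" using z[OF i] i W R by simp
  qed (use W b in auto)
  then have "b \<in> vec_space.col_space T W"
    using W b R by (subst vec_space.col_space_eq[OF W]) (auto intro!: bexI[of _ "- col R 0"])
  with nb show False by simp
qed

end

(* The squared Frobenius norm of the error is the sum, over the columns u_t of U, of the energies
   of u_t^T (Y - Wb X). For t >= rank(Wb) the vector u_t is in the left null space, so these terms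
   do not depend on X; the other u_t span the column space of Wb, so X can be chosen to make the
   remaining terms vanish. The row of ones in the augmented representation restricts X, but if
   b = W c then Wb X is also the forecast for the representation X_top + c (x - 1), where x is
   the last row of X and X_top consists of its other rows. *)

theory Submission
  imports Defs
begin

section \<open>Orthonormal columns of a square matrix: expansion, spans and Parseval\<close>

lemma col_scalar_prod_orthogonal:
  fixes U :: "'a :: field mat"
  assumes "U \<in> carrier_mat n n" and "U\<^sup>T * U = 1\<^sub>m n" and "i < n" and "j < n"
  shows "col U i \<bullet> col U j = (if i = j then 1 else 0)"
proof -
  have "(U\<^sup>T * U) $$ (i, j) = col U i \<bullet> col U j" using assms(1,3,4) by simp
  then show ?thesis using assms(3,4) unfolding assms(2) by simp
qed

text \<open>A left inverse of a square matrix is also a right inverse, so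
  \<open>U * U\<^sup>T\<close> is the identity too.\<close>

lemma mult_transpose_orthogonal_vec:
  fixes U :: "'a :: field mat"
  assumes U: "U \<in> carrier_mat n n" and orth: "U\<^sup>T * U = 1\<^sub>m n" and v: "v \<in> carrier_vec n"
  shows "U *\<^sub>v (U\<^sup>T *\<^sub>v v) = v"
proof -
  have "U * U\<^sup>T = 1\<^sub>m n"
    using mat_mult_left_right_inverse[OF _ U orth] U by simp
  then show ?thesis
    using assoc_mult_mat_vec[of U n n "U\<^sup>T" n v] U v by simp
qed

lemma orthogonal_expansion:
  fixes U :: "'a :: field mat"
  assumes U: "U \<in> carrier_mat n n" and "U\<^sup>T * U = 1\<^sub>m n" and v: "v \<in> carrier_vec n"
    and i: "i < n"
  shows "v $ i = (\<Sum>j<n. (col U j \<bullet> v) * col U j $ i)"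
proof -
  have "v $ i = (U *\<^sub>v (U\<^sup>T *\<^sub>v v)) $ i"
    using mult_transpose_orthogonal_vec[OF assms(1-3)] by simp
  also have "\<dots> = (\<Sum>j<n. (col U j \<bullet> v) * col U j $ i)"
    using U v i by (auto simp: scalar_prod_def lessThan_atLeast0 mult.commute intro!: sum.cong)
  finally show ?thesis .
qed

text \<open>Two equal columns with different indices would have scalar product both 0 and 1.
  Injectivity lets sums and cardinalities over sets of columns be computed over indices.\<close>

lemma inj_on_col_orthogonal:
  fixes U :: "'a :: field mat"
  assumes "U \<in> carrier_mat n n" and "U\<^sup>T * U = 1\<^sub>m n"
  shows "inj_on (col U) {..<n}"
proof (rule inj_onI, rule ccontr)
  fix i j
  assume ij: "i \<in> {..<n}" "j \<in> {..<n}" and eq: "col U i = col U j" and "i \<noteq> j"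
  then have "col U i \<bullet> col U j = 0"
    using col_scalar_prod_orthogonal[OF assms, of i j] by simp
  moreover have "col U i \<bullet> col U i = 1"
    using col_scalar_prod_orthogonal[OF assms, of i i] ij by simp
  ultimately show False using eq by simp
qed

text \<open>The product of the determinants of \<open>U\<^sup>T\<close> and \<open>U\<close> is 1,
  so \<open>U\<close> has full rank; as its columns are distinct, the set of all of them is
  independent, and so is every subset.\<close>

lemma (in vec_space) lin_indpt_cols_orthogonal:
  assumes U: "U \<in> carrier_mat n n" and orth: "U\<^sup>T * U = 1\<^sub>m n" and I: "I \<subseteq> {..<n}"
  shows "lin_indpt (col U ` I)"
proof -
  have "det U \<noteq> 0"
    using det_mult[of "U\<^sup>T" n U] U orth by auto
  then have "rank U = n" using low_rank_det_zero[OF U] by simp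
  moreover have "distinct (cols U)"
    using inj_on_col_orthogonal[OF U orth] U
    by (auto simp: cols_def distinct_map lessThan_atLeast0)
  ultimately have "lin_indpt (set (cols U))"
    using full_rank_lin_indpt[OF U] by simp
  moreover have "col U ` I \<subseteq> set (cols U)"
    using I U by (auto simp: cols_def)
  ultimately show ?thesis using subset_li_is_li by blast
qed

text \<open>Orthonormality kills the coordinates outside \<open>I\<close> of any combination;
  conversely, the orthogonal expansion of a vector without such coordinates uses only columns from
  \<open>I\<close>. Describing spans by vanishing coordinates serves the column space and the left
  null space alike, with complementary index sets.\<close>

lemma (in vec_space) span_cols_orthogonal:
  assumes U: "U \<in> carrier_mat n n" and orth: "U\<^sup>T * U = 1\<^sub>m n" and I: "I \<subseteq> {..<n}"
  shows "span (col U ` I) = {v \<in> carrier_vec n. \<forall>j \<in> {..<n} - I. col U j \<bullet> v = 0}"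
    (is "?L = ?R")
proof (intro equalityI subsetI)
  have fin: "finite (col U ` I)" using I finite_subset by blast
  have car: "col U ` I \<subseteq> carrier_vec n" using U I by auto
  {
    fix v assume "v \<in> ?L"
    then obtain a where v: "v = lincomb a (col U ` I)"
      using finite_span[OF fin] car by auto
    have vc: "v \<in> carrier_vec n" using v car lincomb_closed by auto
    have "col U j \<bullet> v = 0" if j: "j \<in> {..<n} - I" for j
    proof -
      have "col U j \<bullet> v = (\<Sum>i<n. col U j $ i * (\<Sum>x\<in>col U ` I. a x * x $ i))"
        unfolding scalar_prod_def using vc
        by (auto simp: v lincomb_index[OF _ car] lessThan_atLeast0 intro!: sum.cong)
      also have "\<dots> = (\<Sum>x\<in>col U ` I. a x * (\<Sum>i<n. col U j $ i * x $ i))"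
        unfolding sum_distrib_left by (subst sum.swap) (simp add: mult_ac)
      also have "\<dots> = (\<Sum>x\<in>col U ` I. a x * (col U j \<bullet> x))"
        using car by (intro sum.cong) (auto simp: scalar_prod_def lessThan_atLeast0 carrier_matD[OF U])
      also have "\<dots> = 0"
        using j I by (auto intro!: sum.neutral simp: col_scalar_prod_orthogonal[OF U orth])
      finally show ?thesis .
    qed
    with vc show "v \<in> ?R" by auto
  }
  fix v assume v: "v \<in> ?R"
  have "v = lincomb (\<lambda>u. u \<bullet> v) (col U ` I)"
  proof (rule eq_vecI)
    fix i assume "i < dim_vec (lincomb (\<lambda>u. u \<bullet> v) (col U ` I))"
    then have i: "i < n" using lincomb_dim[OF fin car] by simp
    have "v $ i = (\<Sum>j<n. (col U j \<bullet> v) * col U j $ i)"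
      using orthogonal_expansion[OF U orth _ i] v by simp
    also have "\<dots> = (\<Sum>j\<in>I. (col U j \<bullet> v) * col U j $ i)"
      using v I by (intro sum.mono_neutral_right) auto
    \<comment> \<open>\<open>lincomb\<close> sums over a set of vectors, so the change from indices
      to columns relies on the columns being distinct.\<close>
    also have "\<dots> = (\<Sum>u\<in>col U ` I. (u \<bullet> v) * u $ i)"
      using inj_on_subset[OF inj_on_col_orthogonal[OF U orth] I] by (simp add: sum.reindex)
    also have "\<dots> = lincomb (\<lambda>u. u \<bullet> v) (col U ` I) $ i"
      using lincomb_index[OF i car] by simp
    finally show "v $ i = lincomb (\<lambda>u. u \<bullet> v) (col U ` I) $ i" .
  qed (use v lincomb_dim[OF fin car] in simp)
  then show "v \<in> ?L" using finite_span[OF fin] car by auto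
qed

text \<open>Parseval's identity for each column of \<open>E\<close>, followed by an exchange of the
  two sums: \<open>E\<^sup>T *\<^sub>v col U t\<close> collects the coordinates of all columns of
  \<open>E\<close> along the basis vector \<open>col U t\<close>.\<close>

lemma frob_norm_orthogonal:
  assumes U: "U \<in> carrier_mat n n" and orth: "U\<^sup>T * U = 1\<^sub>m n" and E: "E \<in> carrier_mat n d"
  shows "(frob_norm E)\<^sup>2 = (\<Sum>t<n. (euclid_norm (E\<^sup>T *\<^sub>v col U t))\<^sup>2)"
proof -
  have norm: "(\<Sum>t<n. (col U t \<bullet> v)\<^sup>2) = v \<bullet> v" if v: "v \<in> carrier_vec n" for v
  proof -
    have "v \<bullet> v = v \<bullet> (U *\<^sub>v (U\<^sup>T *\<^sub>v v))"
      using mult_transpose_orthogonal_vec[OF U orth v] by simp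
    also have "\<dots> = (U\<^sup>T *\<^sub>v v) \<bullet> (U\<^sup>T *\<^sub>v v)"
      using transpose_vec_mult_scalar[OF U _ v, of "U\<^sup>T *\<^sub>v v"] U v by simp
    also have "\<dots> = (\<Sum>t<n. (col U t \<bullet> v)\<^sup>2)"
      using U by (auto simp: scalar_prod_def[of "U\<^sup>T *\<^sub>v v"] lessThan_atLeast0 power2_eq_square)
    finally show ?thesis by simp
  qed
  have energy: "(euclid_norm (E\<^sup>T *\<^sub>v col U t))\<^sup>2 = (\<Sum>j<d. (col U t \<bullet> col E j)\<^sup>2)"
    if "t < n" for t
  proof -
    have "(euclid_norm (E\<^sup>T *\<^sub>v col U t))\<^sup>2 = (E\<^sup>T *\<^sub>v col U t) \<bullet> (E\<^sup>T *\<^sub>v col U t)"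
      unfolding euclid_norm_def
      by (rule real_sqrt_pow2) (auto simp: scalar_prod_def intro: sum_nonneg)
    also have "\<dots> = (\<Sum>j<d. (col E j \<bullet> col U t)\<^sup>2)"
      using E U
      by (auto simp: scalar_prod_def[of "E\<^sup>T *\<^sub>v col U t"] lessThan_atLeast0 power2_eq_square)
    also have "\<dots> = (\<Sum>j<d. (col U t \<bullet> col E j)\<^sup>2)"
      using E U that by (intro sum.cong) (auto simp: comm_scalar_prod[of _ n])
    finally show ?thesis .
  qed
  have "(frob_norm E)\<^sup>2 = (\<Sum>i<n. \<Sum>j<d. (E $$ (i, j))\<^sup>2)"
    using E unfolding frob_norm_def by (simp add: real_sqrt_pow2 sum_nonneg)
  also have "\<dots> = (\<Sum>j<d. col E j \<bullet> col E j)"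
    using E by (subst sum.swap)
      (auto simp: scalar_prod_def lessThan_atLeast0 power2_eq_square intro!: sum.cong)
  also have "\<dots> = (\<Sum>j<d. \<Sum>t<n. (col U t \<bullet> col E j)\<^sup>2)"
    using E by (intro sum.cong) (auto simp: norm)
  also have "\<dots> = (\<Sum>t<n. (euclid_norm (E\<^sup>T *\<^sub>v col U t))\<^sup>2)"
    by (subst sum.swap) (simp add: energy)
  finally show ?thesis .
qed

section \<open>Forecasts as products with the augmented weights\<close>

lemma forecast_eq_aug:
  assumes W: "W \<in> carrier_mat n l" and b: "b \<in> carrier_vec n" and R: "R \<in> carrier_mat l d"
  shows "forecast W b R = aug_weights W b * aug_repr R"
proof -
  have rowW: "row (aug_weights W b) i = row W i @\<^sub>v vec 1 (\<lambda>_. b $ i)" if "i < n" for i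
    using that W b by (intro eq_vecI)
      (auto simp: aug_weights_def mat_of_cols_index nth_append less_Suc_eq)
  have colR: "col (aug_repr R) j = col R j @\<^sub>v vec 1 (\<lambda>_. 1)" if "j < d" for j
    using that R by (intro eq_vecI) (auto simp: aug_repr_def append_rows_def)
  have "row (aug_weights W b) i \<bullet> col (aug_repr R) j = row W i \<bullet> col R j + b $ i"
    if "i < n" "j < d" for i j
    unfolding rowW[OF that(1)] colR[OF that(2)] using that W R
    by (subst scalar_prod_append[of _ l _ 1]) (auto simp: scalar_prod_def)
  then show ?thesis
    using W R by (intro eq_matI)
      (auto simp: forecast_def aug_weights_def aug_repr_def append_rows_def)
qed

text \<open>When the bias is \<open>W *\<^sub>v c\<close>, a last row of \<open>X\<close> different
  from ones gives no new outputs: its excess over one multiplies \<open>W *\<^sub>v c\<close>, and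
  \<open>W\<close> can be factored out, so that the excess is absorbed into the
  representation.\<close>

lemma aug_mult_eq_forecast:
  assumes W: "W \<in> carrier_mat n l" and c: "c \<in> carrier_vec l" and X: "X \<in> carrier_mat (l + 1) d"
  shows "aug_weights W (W *\<^sub>v c) * X =
    forecast W (W *\<^sub>v c) (mat l d (\<lambda>(i, j). X $$ (i, j) + c $ i * (X $$ (l, j) - 1)))"
    (is "_ = forecast W _ ?R")
proof (rule eq_matI)
  fix i j
  assume "i < dim_row (forecast W (W *\<^sub>v c) ?R)" and "j < dim_col (forecast W (W *\<^sub>v c) ?R)"
  then have i: "i < n" and j: "j < d" using W by (auto simp: forecast_def)
  have "(aug_weights W (W *\<^sub>v c) * X) $$ (i, j)
      = (\<Sum>k<l. W $$ (i, k) * X $$ (k, j)) + (\<Sum>k<l. W $$ (i, k) * c $ k) * X $$ (l, j)"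
    using i j W c X
    by (auto simp: aug_weights_def scalar_prod_def mat_of_cols_index nth_append lessThan_atLeast0
        intro!: sum.cong)
  also have "\<dots> = (\<Sum>k<l. W $$ (i, k) * (X $$ (k, j) + c $ k * (X $$ (l, j) - 1)))
      + (\<Sum>k<l. W $$ (i, k) * c $ k)"
    by (simp add: algebra_simps sum.distrib sum_subtractf sum_distrib_left)
  also have "\<dots> = forecast W (W *\<^sub>v c) ?R $$ (i, j)"
    using i j W c by (auto simp: forecast_def scalar_prod_def lessThan_atLeast0)
  finally show "(aug_weights W (W *\<^sub>v c) * X) $$ (i, j) = forecast W (W *\<^sub>v c) ?R $$ (i, j)" .
qed (use W X in \<open>auto simp: forecast_def aug_weights_def\<close>)

section \<open>Rank, column space and left null space from the singular value decomposition\<close>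

lemma is_svd_positive_prefix:
  assumes "is_svd A U S V"
  obtains k where "k \<le> min (dim_row A) (dim_col A)"
    and "\<And>i. i < min (dim_row A) (dim_col A) \<Longrightarrow>
      if i < k then 0 < S $$ (i, i) else S $$ (i, i) = 0"
proof -
  let ?m = "min (dim_row A) (dim_col A)"
  \<comment> \<open>The first diagonal position without a positive entry. The disjunct
    \<open>?m \<le> i\<close> guarantees that the minimum exists and gives \<open>k = ?m\<close> if
    all diagonal entries are positive.\<close>
  define k where "k = (LEAST i. ?m \<le> i \<or> S $$ (i, i) \<le> 0)"
  have stop: "?m \<le> k \<or> S $$ (k, k) \<le> 0"
    unfolding k_def by (rule LeastI[of _ ?m]) simp
  show thesis
  proof (rule that)
    show "k \<le> ?m" unfolding k_def by (rule Least_le) simp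
    fix i assume i: "i < ?m"
    show "if i < k then 0 < S $$ (i, i) else S $$ (i, i) = 0"
    proof (cases "i < k")
      case True
      with i show ?thesis using not_less_Least[of i "\<lambda>i. ?m \<le> i \<or> S $$ (i, i) \<le> 0"]
        by (simp add: k_def)
    next
      case False
      \<comment> \<open>Positive singular values come first, so a positive entry at or after
        position \<open>k\<close> would force one at \<open>k\<close>.\<close>
      have "0 < S $$ (i, i) \<longrightarrow> 0 < S $$ (k, k)"
        using assms False i unfolding is_svd_def by (meson not_less)
      then have "\<not> 0 < S $$ (i, i)"
        using stop i False by auto
      moreover have "0 \<le> S $$ (i, i)" using assms i unfolding is_svd_def by blast
      ultimately show ?thesis using False by simp
    qed
  qed
qed

text \<open>In the coordinates given by \<open>U\<close> and \<open>V\<close> the map is diagonal: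
  it reaches exactly the first \<open>k\<close> coordinates, and its transpose kills exactly the
  others. Here \<open>k\<close> counts the positive singular values; that it is the rank is shown
  afterwards.\<close>

lemma is_svd_col_space_kernel:
  assumes svd: "is_svd A U S V" and A: "A \<in> carrier_mat n m"
  obtains k where "k \<le> min n m"
    and "vec_space.col_space n A = {v \<in> carrier_vec n. \<forall>t\<in>{k..<n}. col U t \<bullet> v = 0}"
    and "left_null_space A = {v \<in> carrier_vec n. \<forall>t<k. col U t \<bullet> v = 0}"
proof -
  obtain k where km: "k \<le> min n m"
    and pos: "\<And>i. i < min n m \<Longrightarrow> if i < k then 0 < S $$ (i, i) else S $$ (i, i) = 0"
    using is_svd_positive_prefix[OF svd] A by auto
  have U: "U \<in> carrier_mat n n" and orthU: "U\<^sup>T * U = 1\<^sub>m n"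
    and V: "V \<in> carrier_mat m m" and orthV: "V\<^sup>T * V = 1\<^sub>m m"
    and S: "S \<in> carrier_mat n m" and diag: "diagonal_mat S" and AUSV: "A = U * S * V\<^sup>T"
    using svd A by (auto simp: is_svd_def)
  have Ax: "A *\<^sub>v x = U *\<^sub>v (S *\<^sub>v (V\<^sup>T *\<^sub>v x))" if "x \<in> carrier_vec m" for x
    unfolding AUSV using that U V S
    by (simp add: assoc_mult_mat_vec[of "U * S" n m "V\<^sup>T" m] assoc_mult_mat_vec[of U n n S m]
        del: assoc_mult_mat)
  have AT: "A\<^sup>T *\<^sub>v v = V *\<^sub>v (S\<^sup>T *\<^sub>v (U\<^sup>T *\<^sub>v v))" if "v \<in> carrier_vec n" for v
  proof -
    have "A\<^sup>T = V * (S\<^sup>T * U\<^sup>T)"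
      unfolding AUSV using U V S
      by (simp add: transpose_mult[of "U * S" n m "V\<^sup>T" m] transpose_mult[of U n n S m]
          del: assoc_mult_mat)
    then show ?thesis
      using that U V S
      by (simp add: assoc_mult_mat_vec[of V m m "S\<^sup>T * U\<^sup>T" n]
          assoc_mult_mat_vec[of "S\<^sup>T" m n "U\<^sup>T" n])
  qed
  have UTU: "U\<^sup>T *\<^sub>v (U *\<^sub>v w) = w" if "w \<in> carrier_vec n" for w
    using assoc_mult_mat_vec[of "U\<^sup>T" n n U n w] U that orthU by simp
  have VTV: "V\<^sup>T *\<^sub>v (V *\<^sub>v w) = w" if "w \<in> carrier_vec m" for w
    using assoc_mult_mat_vec[of "V\<^sup>T" m m V m w] V that orthV by simp
  have pos_diag: "0 < S $$ (i, i)" if "i < k" for i using pos[of i] that km by simp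
  have zero_diag: "S $$ (i, i) = 0" if "k \<le> i" "i < n" "i < m" for i using pos[of i] that by simp
  have off: "S $$ (i, j) = 0" if "i < n" "j < m" "i \<noteq> j" for i j
    using diag S that by (auto simp: diagonal_mat_def)
  \<comment> \<open>\<open>S\<close> need not be square: its rows from \<open>m\<close> on vanish,
    and likewise the rows of \<open>S\<^sup>T\<close> from \<open>n\<close> on in
    \<open>STx\<close>.\<close>
  have Sx: "(S *\<^sub>v x) $ i = (if i < m then S $$ (i, i) * x $ i else 0)"
    if "x \<in> carrier_vec m" "i < n" for x i
  proof -
    have "(S *\<^sub>v x) $ i = (\<Sum>j\<in>{0..<m}. S $$ (i, j) * x $ j)"
      using that S by (auto simp: scalar_prod_def)
    also have "\<dots> = (\<Sum>j\<in>{0..<m}. if j = i then S $$ (i, i) * x $ i else 0)"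
      using that off by (intro sum.cong) auto
    finally show ?thesis by simp
  qed
  have STx: "(S\<^sup>T *\<^sub>v x) $ i = (if i < n then S $$ (i, i) * x $ i else 0)"
    if "x \<in> carrier_vec n" "i < m" for x i
  proof -
    have "(S\<^sup>T *\<^sub>v x) $ i = (\<Sum>j\<in>{0..<n}. S $$ (j, i) * x $ j)"
      using that S by (auto simp: scalar_prod_def)
    also have "\<dots> = (\<Sum>j\<in>{0..<n}. if j = i then S $$ (i, i) * x $ i else 0)"
      using that off by (intro sum.cong) auto
    finally show ?thesis by simp
  qed
  have coord: "(U\<^sup>T *\<^sub>v v) $ t = col U t \<bullet> v" if "t < n" for v t
    using that U by simp
  \<comment> \<open>\<open>V\<close> is injective, so the kernel of \<open>A\<^sup>T\<close> is
    determined by the diagonal factor applied to the coordinates of \<open>v\<close>.\<close>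
  have null: "A\<^sup>T *\<^sub>v v = 0\<^sub>v m \<longleftrightarrow> (\<forall>t<k. col U t \<bullet> v = 0)" if v: "v \<in> carrier_vec n" for v
  proof -
    have V0: "M *\<^sub>v 0\<^sub>v m = 0\<^sub>v m" if "M \<in> carrier_mat m m" for M :: "real mat"
      using that by (intro eq_vecI) auto
    have STU: "S\<^sup>T *\<^sub>v (U\<^sup>T *\<^sub>v v) \<in> carrier_vec m"
      using U S v by (intro mult_mat_vec_carrier[of _ m n] mult_mat_vec_carrier[of _ n n]) auto
    have "A\<^sup>T *\<^sub>v v = 0\<^sub>v m \<longleftrightarrow> S\<^sup>T *\<^sub>v (U\<^sup>T *\<^sub>v v) = 0\<^sub>v m"
    proof
      assume "A\<^sup>T *\<^sub>v v = 0\<^sub>v m"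
      then have "V\<^sup>T *\<^sub>v (V *\<^sub>v (S\<^sup>T *\<^sub>v (U\<^sup>T *\<^sub>v v))) = V\<^sup>T *\<^sub>v 0\<^sub>v m"
        using AT[OF v] by simp
      then show "S\<^sup>T *\<^sub>v (U\<^sup>T *\<^sub>v v) = 0\<^sub>v m"
        using VTV[OF STU] V0[of "V\<^sup>T"] V by simp
    next
      assume "S\<^sup>T *\<^sub>v (U\<^sup>T *\<^sub>v v) = 0\<^sub>v m"
      then show "A\<^sup>T *\<^sub>v v = 0\<^sub>v m" using AT[OF v] V0[OF V] by simp
    qed
    also have "\<dots> \<longleftrightarrow> (\<forall>i<m. (S\<^sup>T *\<^sub>v (U\<^sup>T *\<^sub>v v)) $ i = 0)"
      using STU S by (auto simp: vec_eq_iff)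
    also have "\<dots> \<longleftrightarrow> (\<forall>i<m. i < n \<longrightarrow> S $$ (i, i) * (col U i \<bullet> v) = 0)"
      using U v by (auto simp: STx[OF mult_mat_vec_carrier[of "U\<^sup>T" n n v]] coord)
    also have "\<dots> \<longleftrightarrow> (\<forall>t<k. col U t \<bullet> v = 0)"
    proof (intro iffI allI impI)
      fix t
      assume "\<forall>i<m. i < n \<longrightarrow> S $$ (i, i) * (col U i \<bullet> v) = 0" and "t < k"
      then show "col U t \<bullet> v = 0" using pos_diag[of t] km by (auto dest!: spec[of _ t])
    next
      fix i
      assume "\<forall>t<k. col U t \<bullet> v = 0" and "i < m" and "i < n"
      then show "S $$ (i, i) * (col U i \<bullet> v) = 0" using zero_diag[of i] by (cases "i < k") auto
    qed
    finally show ?thesis .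
  qed
  have range: "(\<exists>x\<in>carrier_vec m. A *\<^sub>v x = v) \<longleftrightarrow> (\<forall>t\<in>{k..<n}. col U t \<bullet> v = 0)"
    if v: "v \<in> carrier_vec n" for v
  proof
    assume "\<exists>x\<in>carrier_vec m. A *\<^sub>v x = v"
    then obtain x where x: "x \<in> carrier_vec m" and v_eq: "v = A *\<^sub>v x" by auto
    have "U\<^sup>T *\<^sub>v v = S *\<^sub>v (V\<^sup>T *\<^sub>v x)" unfolding v_eq Ax[OF x] 
      using S V x by (intro UTU mult_mat_vec_carrier[of S n m] mult_mat_vec_carrier[of _ m m]) auto
    then show "\<forall>t\<in>{k..<n}. col U t \<bullet> v = 0"
      using zero_diag V x by (auto simp: coord[symmetric] Sx[OF mult_mat_vec_carrier[of "V\<^sup>T" m m x]])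
  next
    assume z: "\<forall>t\<in>{k..<n}. col U t \<bullet> v = 0"
    \<comment> \<open>Dividing the first \<open>k\<close> coordinates by their singular values
      inverts \<open>S\<close> where possible; \<open>V *\<^sub>v y\<close> is the image of
      \<open>v\<close> under the pseudoinverse of \<open>A\<close>.\<close>
    define y where "y = vec m (\<lambda>i. if i < k then (col U i \<bullet> v) / S $$ (i, i) else 0)"
    have y: "y \<in> carrier_vec m" by (simp add: y_def)
    have Vy: "V *\<^sub>v y \<in> carrier_vec m" using V y by simp
    have "S *\<^sub>v y = U\<^sup>T *\<^sub>v v"
    proof (rule eq_vecI)
      fix i assume "i < dim_vec (U\<^sup>T *\<^sub>v v)"
      then have i: "i < n" using U by simp
      show "(S *\<^sub>v y) $ i = (U\<^sup>T *\<^sub>v v) $ i"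
        unfolding Sx[OF y i] coord[OF i] using z i km pos_diag[of i] zero_diag[of i]
        by (cases "i < k") (auto simp: y_def)
    qed (use S U in simp)
    then have "A *\<^sub>v (V *\<^sub>v y) = v"
      using Ax[OF Vy] VTV[OF y] mult_transpose_orthogonal_vec[OF U orthU v] by simp
    then show "\<exists>x\<in>carrier_vec m. A *\<^sub>v x = v" using Vy by blast
  qed
  show thesis
  proof (rule that[OF km])
    show "vec_space.col_space n A = {v \<in> carrier_vec n. \<forall>t\<in>{k..<n}. col U t \<bullet> v = 0}"
      using vec_space.col_space_eq[OF A] A range by auto
    show "left_null_space A = {v \<in> carrier_vec n. \<forall>t<k. col U t \<bullet> v = 0}"
      using A null by (auto simp: left_null_space_def mat_kernel_def)
  qed
qed

text \<open>The first \<open>k\<close> columns of \<open>U\<close> are independent and span the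
  column space, so its dimension is \<open>k\<close>, and the rank can replace \<open>k\<close> in
  both descriptions.\<close>

lemma is_svd_rank:
  assumes svd: "is_svd A U S V" and A: "A \<in> carrier_mat n m"
  defines "r \<equiv> vec_space.rank n A"
  shows "r \<le> min n m"
    and "vec_space.col_space n A = {v \<in> carrier_vec n. \<forall>t\<in>{r..<n}. col U t \<bullet> v = 0}"
    and "left_null_space A = {v \<in> carrier_vec n. \<forall>t<r. col U t \<bullet> v = 0}"
proof -
  interpret vec_space "TYPE(real)" n .
  obtain k where km: "k \<le> min n m"
    and cs: "col_space A = {v \<in> carrier_vec n. \<forall>t\<in>{k..<n}. col U t \<bullet> v = 0}"
    and ns: "left_null_space A = {v \<in> carrier_vec n. \<forall>t<k. col U t \<bullet> v = 0}"
    using is_svd_col_space_kernel[OF svd A] by blast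
  have U: "U \<in> carrier_mat n n" and orth: "U\<^sup>T * U = 1\<^sub>m n"
    using svd A by (auto simp: is_svd_def)
  have k: "{..<k} \<subseteq> {..<n}" using km by auto
  have "{..<n} - {..<k} = {k..<n}" by auto
  then have "span (set (cols A)) = span (col U ` {..<k})"
    using span_cols_orthogonal[OF U orth k] cs by (simp add: col_space_def)
  \<comment> \<open>\<open>dim_span\<close> obtains the dimension from a maximal independent subset
    of a spanning set; here the whole set is independent.\<close>
  moreover have "maximal (col U ` {..<k}) (\<lambda>T. T \<subseteq> col U ` {..<k} \<and> lin_indpt T)"
    using lin_indpt_cols_orthogonal[OF U orth k] by (auto simp: maximal_def)
  then have "vectorspace.dim class_ring (span_vs (col U ` {..<k})) = card (col U ` {..<k})"
    using U k by (intro dim_span) auto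
  moreover have "card (col U ` {..<k}) = k"
    using inj_on_subset[OF inj_on_col_orthogonal[OF U orth] k] by (simp add: card_image)
  ultimately have "r = k" by (simp add: r_def rank_def)
  with km cs ns show "r \<le> min n m"
    and "col_space A = {v \<in> carrier_vec n. \<forall>t\<in>{r..<n}. col U t \<bullet> v = 0}"
    and "left_null_space A = {v \<in> carrier_vec n. \<forall>t<r. col U t \<bullet> v = 0}"
    by simp_all
qed

text \<open>The left null space consists of the vectors with no coordinates along the first
  \<open>r\<close> columns, which is the span of the remaining ones.\<close>

lemma svd_left_null_basis:
  assumes svd: "is_svd A U S V" and A: "A \<in> carrier_mat n m"
  defines "r \<equiv> vec_space.rank n A"
  shows "is_orthonormal_basis n {r..<n} (col U) (left_null_space A)"
proof -
  interpret vec_space "TYPE(real)" n .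
  have U: "U \<in> carrier_mat n n" and orth: "U\<^sup>T * U = 1\<^sub>m n"
    using svd A by (auto simp: is_svd_def)
  note rank = is_svd_rank[OF svd A, folded r_def]
  have "{..<n} - {r..<n} = {..<r}" using rank(1) by auto
  then have "span (col U ` {r..<n}) = left_null_space A"
    using span_cols_orthogonal[OF U orth, of "{r..<n}"] rank(3)
    by (simp add: subset_iff lessThan_def)
  then show ?thesis
    using U col_scalar_prod_orthogonal[OF U orth] by (auto simp: is_orthonormal_basis_def)
qed

section \<open>The error \<open>Y - A * X\<close> along the columns of \<open>U\<close>\<close>

lemma svd_error_left_null:
  assumes svd: "is_svd A U S V" and A: "A \<in> carrier_mat n m"
    and Y: "Y \<in> carrier_mat n d" and X: "X \<in> carrier_mat m d"
    and t: "t \<in> {vec_space.rank n A..<n}"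
  shows "(Y - A * X)\<^sup>T *\<^sub>v col U t = Y\<^sup>T *\<^sub>v col U t"
proof -
  have U: "U \<in> carrier_mat n n" and orth: "U\<^sup>T * U = 1\<^sub>m n"
    using svd A by (auto simp: is_svd_def)
  have u: "col U t \<in> carrier_vec n" using U t by auto
  have "col U t \<in> left_null_space A"
    using is_svd_rank(3)[OF svd A] u t
      col_scalar_prod_orthogonal[OF U orth] by auto
  then have "A\<^sup>T *\<^sub>v col U t = 0\<^sub>v m"
    using A by (simp add: left_null_space_def mat_kernel_def)
  \<comment> \<open>Since \<open>(A * X)\<^sup>T\<close> factors as
    \<open>X\<^sup>T * A\<^sup>T\<close>, the fitted part is orthogonal to \<open>col U t\<close>
    whatever \<open>X\<close> is.\<close>
  then have "(A * X)\<^sup>T *\<^sub>v col U t = 0\<^sub>v d"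
    using A X u by (auto simp: transpose_mult[OF A X] assoc_mult_mat_vec[of "X\<^sup>T" d m "A\<^sup>T" n])
  moreover have "(Y - A * X)\<^sup>T = Y\<^sup>T - (A * X)\<^sup>T"
    using A X Y by (intro eq_matI) auto
  ultimately show ?thesis
    using A X Y u by (simp add: minus_mult_distrib_mat_vec[of _ d n])
qed

text \<open>By Parseval the squared error is a sum of nonnegative energies; those with index below
  the rank are dropped, and the rest do not depend on \<open>X\<close>.\<close>

lemma svd_error_lower_bound:
  assumes svd: "is_svd A U S V" and A: "A \<in> carrier_mat n m"
    and Y: "Y \<in> carrier_mat n d" and X: "X \<in> carrier_mat m d"
  shows "residual_energy n U (vec_space.rank n A) Y \<le> (frob_norm (Y - A * X))\<^sup>2"
proof -
  let ?r = "vec_space.rank n A"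
  have U: "U \<in> carrier_mat n n" and orth: "U\<^sup>T * U = 1\<^sub>m n"
    using svd A by (auto simp: is_svd_def)
  have E: "Y - A * X \<in> carrier_mat n d" using A X Y by auto
  have "residual_energy n U ?r Y = (\<Sum>t\<in>{?r..<n}. (euclid_norm ((Y - A * X)\<^sup>T *\<^sub>v col U t))\<^sup>2)"
    unfolding residual_energy_def using svd_error_left_null[OF svd A Y X] by simp
  also have "\<dots> \<le> (\<Sum>t<n. (euclid_norm ((Y - A * X)\<^sup>T *\<^sub>v col U t))\<^sup>2)"
    by (intro sum_mono2) auto
  finally show ?thesis using frob_norm_orthogonal[OF U orth E] by simp
qed

text \<open>Least squares, one column of \<open>Y\<close> at a time: fitting the orthogonal
  projection onto the column space removes every energy with index below the rank.\<close>

lemma svd_error_attained: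
  assumes svd: "is_svd A U S V" and A: "A \<in> carrier_mat n m" and Y: "Y \<in> carrier_mat n d"
  obtains X where "X \<in> carrier_mat m d"
    and "(frob_norm (Y - A * X))\<^sup>2 = residual_energy n U (vec_space.rank n A) Y"
proof -
  let ?r = "vec_space.rank n A"
  have U: "U \<in> carrier_mat n n" and orth: "U\<^sup>T * U = 1\<^sub>m n"
    using svd A by (auto simp: is_svd_def)
  \<comment> \<open>\<open>z j\<close> is the orthogonal projection of \<open>col Y j\<close> onto
    the column space of \<open>A\<close>, built by keeping only the coordinates below the
    rank.\<close>
  define z where "z j = U *\<^sub>v vec n (\<lambda>t. if t < ?r then col U t \<bullet> col Y j else 0)" for j
  have z: "z j \<in> carrier_vec n" for j using U by (simp add: z_def)
  have coord: "col U t \<bullet> z j = (if t < ?r then col U t \<bullet> col Y j else 0)" if t: "t < n" for t j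
  proof -
    let ?w = "vec n (\<lambda>t. if t < ?r then col U t \<bullet> col Y j else 0)"
    have "U\<^sup>T *\<^sub>v z j = ?w"
      using assoc_mult_mat_vec[of "U\<^sup>T" n n U n ?w] U orth by (simp add: z_def)
    moreover have "col U t \<bullet> z j = (U\<^sup>T *\<^sub>v z j) $ t" using t U by simp
    ultimately show ?thesis using t by simp
  qed
  have "z j \<in> vec_space.col_space n A" for j
    using is_svd_rank(2)[OF svd A] z coord by auto
  then have "\<exists>x. x \<in> carrier_vec m \<and> A *\<^sub>v x = z j" for j
    using vec_space.col_space_eq[OF A] A by blast
  then obtain x where x: "x j \<in> carrier_vec m" and Ax: "A *\<^sub>v x j = z j" for j by metis
  define X where "X = mat_of_cols m (map x [0..<d])"
  have X: "X \<in> carrier_mat m d" unfolding X_def by (rule carrier_matI) simp_all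
  have colAX: "col (A * X) j = z j" if "j < d" for j
    using col_mult2[OF A X that] that x by (simp add: X_def Ax)
  have E: "Y - A * X \<in> carrier_mat n d" using A X Y by auto
  \<comment> \<open>Below the rank, \<open>z j\<close> and \<open>col Y j\<close> have the same
    coordinates, so their difference has none there.\<close>
  have "(Y - A * X)\<^sup>T *\<^sub>v col U t = 0\<^sub>v d" if t: "t < ?r" for t
  proof (rule eq_vecI)
    have tn: "t < n" using t is_svd_rank(1)[OF svd A] by simp
    fix j assume "j < dim_vec (0\<^sub>v d)"
    then have j: "j < d" by simp
    have "col (Y - A * X) j = col Y j - z j"
      using j A X Y colAX[OF j, symmetric] by (intro eq_vecI) auto
    then have "((Y - A * X)\<^sup>T *\<^sub>v col U t) $ j = (col Y j - z j) \<bullet> col U t"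
      using j E A X by simp
    also have "\<dots> = col U t \<bullet> (col Y j - z j)"
      using j Y z[of j] U tn by (intro comm_scalar_prod[of _ n]) auto
    also have "\<dots> = 0"
      using j Y z[of j] U tn t coord[OF tn, of j] by (simp add: scalar_prod_minus_distrib[of _ n])
    finally show "((Y - A * X)\<^sup>T *\<^sub>v col U t) $ j = 0\<^sub>v d $ j" using j by simp
  qed (use E in auto)
  then have zero: "(euclid_norm ((Y - A * X)\<^sup>T *\<^sub>v col U t))\<^sup>2 = 0" if "t < ?r" for t
    using that by (simp add: euclid_norm_def)
  have "(frob_norm (Y - A * X))\<^sup>2
      = (\<Sum>t\<in>{?r..<n}. (euclid_norm ((Y - A * X)\<^sup>T *\<^sub>v col U t))\<^sup>2)"
    unfolding frob_norm_orthogonal[OF U orth E] using zero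
    by (intro sum.mono_neutral_right) auto
  also have "\<dots> = residual_energy n U ?r Y"
    unfolding residual_energy_def using svd_error_left_null[OF svd A Y X] by simp
  finally show thesis using that X by blast
qed

text \<open>The minimum over genuine representations is claimed for a bias in the column space of
  \<open>W\<close>, since otherwise the row of ones can keep the lower bound from being attained.
  The last conjunct frees that row and holds for every bias. Independence of the representation is
  stated for each component of the error in the left null space.\<close>

theorem theorem3p1:
  fixes T L D r :: nat and W Wb Y U S V :: "real mat" and b :: "real vec"
  assumes "1 \<le> T" and "1 \<le> L" and "1 \<le> D"
    and "W \<in> carrier_mat T L" and "b \<in> carrier_vec T" and "Y \<in> carrier_mat T D"
    and "Wb = aug_weights W b"
    and "is_svd Wb U S V"
    and "r = vec_space.rank T Wb"
  shows "(\<forall>R \<in> carrier_mat L D. forecast W b R = Wb * aug_repr R) \<and>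
    r \<le> min T (L + 1) \<and>
    is_orthonormal_basis T {r..<T} (col U) (left_null_space Wb) \<and>
    (\<forall>R \<in> carrier_mat L D. \<forall>t \<in> {r..<T}.
        (Y - forecast W b R)\<^sup>T *\<^sub>v col U t = Y\<^sup>T *\<^sub>v col U t) \<and>
    (\<forall>R \<in> carrier_mat L D.
        residual_energy T U r Y \<le> (frob_norm (Y - forecast W b R))\<^sup>2) \<and>
    (b \<in> vec_space.col_space T W \<longrightarrow>
      is_minimum (residual_energy T U r Y)
        {(frob_norm (Y - forecast W b R))\<^sup>2 | R. R \<in> carrier_mat L D}) \<and>
    is_minimum (residual_energy T U r Y)
        {(frob_norm (Y - Wb * X))\<^sup>2 | X. X \<in> carrier_mat (L + 1) D}"
proof (intro conjI ballI impI)
  note W = assms(4) and b = assms(5) and Y = assms(6) and svd = assms(8) and r = assms(9)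
  have A: "Wb \<in> carrier_mat T (L + 1)"
    using W unfolding assms(7) aug_weights_def carrier_mat_def by simp
  have fore: "forecast W b R = Wb * aug_repr R" if "R \<in> carrier_mat L D" for R
    using forecast_eq_aug[OF W b that] assms(7) by simp
  have aug: "aug_repr R \<in> carrier_mat (L + 1) D" if "R \<in> carrier_mat L D" for R
    using that unfolding aug_repr_def by (intro carrier_append_rows) auto
  have lower: "residual_energy T U r Y \<le> (frob_norm (Y - Wb * X))\<^sup>2"
    if "X \<in> carrier_mat (L + 1) D" for X
    using svd_error_lower_bound[OF svd A Y that] r by simp
  have lower_forecast: "residual_energy T U r Y \<le> (frob_norm (Y - forecast W b R))\<^sup>2"
    if "R \<in> carrier_mat L D" for R
    unfolding fore[OF that] by (rule lower[OF aug[OF that]])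
  \<comment> \<open>An unconstrained minimizer, whose last row need not consist of ones. It settles
    the last conjunct directly and is converted below into a representation.\<close>
  obtain X where X: "X \<in> carrier_mat (L + 1) D"
    and opt: "(frob_norm (Y - Wb * X))\<^sup>2 = residual_energy T U r Y"
    using svd_error_attained[OF svd A Y] r by blast
  show "r \<le> min T (L + 1)" using is_svd_rank(1)[OF svd A] r by simp
  show "is_orthonormal_basis T {r..<T} (col U) (left_null_space Wb)"
    using svd_left_null_basis[OF svd A] r by simp
  show "is_minimum (residual_energy T U r Y)
      {(frob_norm (Y - Wb * X))\<^sup>2 | X. X \<in> carrier_mat (L + 1) D}"
    using X opt[symmetric] lower unfolding is_minimum_def by blast
  {
    fix R :: "real mat" assume R: "R \<in> carrier_mat L D"
    show "forecast W b R = Wb * aug_repr R" by (rule fore[OF R])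
    show "residual_energy T U r Y \<le> (frob_norm (Y - forecast W b R))\<^sup>2"
      by (rule lower_forecast[OF R])
    show "(Y - forecast W b R)\<^sup>T *\<^sub>v col U t = Y\<^sup>T *\<^sub>v col U t" if "t \<in> {r..<T}" for t
      unfolding fore[OF R] using svd_error_left_null[OF svd A Y aug[OF R]] that r by simp
  }
  assume "b \<in> vec_space.col_space T W"
  then obtain c where c: "c \<in> carrier_vec L" and "b = W *\<^sub>v c"
    unfolding vec_space.col_space_eq[OF W] using W by auto
  \<comment> \<open>Row \<open>L\<close>, counted from 0, is the last row of \<open>X\<close>; its
    excess over one is moved into the other rows along \<open>c\<close>, which leaves the output
    \<open>Wb * X\<close> unchanged.\<close>
  define R where "R = mat L D (\<lambda>(i, j). X $$ (i, j) + c $ i * (X $$ (L, j) - 1))"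
  have R: "R \<in> carrier_mat L D" by (simp add: R_def)
  have "Wb * X = forecast W b R"
    using aug_mult_eq_forecast[OF W c X] unfolding assms(7) R_def \<open>b = W *\<^sub>v c\<close> .
  then have "residual_energy T U r Y = (frob_norm (Y - forecast W b R))\<^sup>2"
    using opt by simp
  with R show "is_minimum (residual_energy T U r Y)
      {(frob_norm (Y - forecast W b R))\<^sup>2 | R. R \<in> carrier_mat L D}"
    using lower_forecast unfolding is_minimum_def by blast
qed

end
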